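(* The generating function $S(y,z)\equiv S(x;y,z)=\sum_{h,k\geq 1}S_{h,k}\,y^hz^k$, where $S_{h,k}\equiv S_{h,k}(x)$ is the size generating function (in the variable $x$) of semi-Baxter permutations having label $(h,k)$, satisfies $$S(y,z)=xyz+\frac{xyz}{1-y}\bigl(S(1,z)-S(y,z)\bigr)+\frac{xyz}{z-y}\bigl(S(y,z)-S(y,y)\bigr).$$
   Context: A permutation $\pi=\pi_1\cdots\pi_n$ of $\{1,\dots,n\}$ is semi-Baxter if there are no indices $i<j$ and $k>j+1$ with $\pi_{j+1}<\pi_i<\pi_k<\pi_j$. For a permutation $\pi$ of size $n$ and $a\in\{1,\dots,n+1\}$, $\pi\cdot a$ is the permutation $\pi'$ of size $n+1$ with $\pi'_{n+1}=a$ and, for $i\leq n$, $\pi'_i=\pi_i$ if $\pi_i<a$ and $\pi'_i=\pi_i+1$ if $\pi_i\geq a$. The active sites of a semi-Baxter permutation $\pi$ of size $n$ are the values $a\in\{1,\dots,n+1\}$ such that $\pi\cdot a$ is semi-Baxter. The label of $\pi$ is $(h,k)$, where $h$ (resp. $k$) is the number of active sites $a$ of $\pi$ with $a\leq\pi_n$ (resp. $a>\pi_n$). $S_{h,k}(x)=\sum_{\pi}x^{|\pi|}$, the sum being over semi-Baxter permutations $\pi$ (of size $|\pi|\geq 1$) with label $(h,k)$. $S(y,z)$ is a formal power series in $x$ with polynomial coefficients in $y,z$. *)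

theory Defs
  imports
    "HOL-Combinatorics.Multiset_Permutations"
    "HOL-Computational_Algebra.Computational_Algebra"
    "HOL-Analysis.Infinite_Sum"
begin

text \<open>
  A permutation of \<open>{1..n}\<close> is the list of its values in one-line notation. List positions
  start at 0, so \<open>p ! i\<close> is the entry \<open>\<pi>\<^sub>i\<^sub>+\<^sub>1\<close>; the avoidance condition only compares positions with
  one another and is not affected by the shift.
\<close>

definition semi_baxter :: "nat list \<Rightarrow> bool" where
  "semi_baxter p \<longleftrightarrow> p \<in> permutations_of_set {1..length p} \<and>
     \<not> (\<exists>i j k. i < j \<and> j + 1 < k \<and> k < length p \<and>
          p ! (j + 1) < p ! i \<and> p ! i < p ! k \<and> p ! k < p ! j)"

definition append_value :: "nat list \<Rightarrow> nat \<Rightarrow> nat list" where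
  "append_value p a = map (\<lambda>v. if v < a then v else v + 1) p @ [a]"

definition active_sites :: "nat list \<Rightarrow> nat set" where
  "active_sites p = {a \<in> {1..length p + 1}. semi_baxter (append_value p a)}"

definition label :: "nat list \<Rightarrow> nat \<times> nat" where
  "label p = (card {a \<in> active_sites p. a \<le> last p}, card {a \<in> active_sites p. a > last p})"

definition label_class :: "nat \<Rightarrow> nat \<Rightarrow> nat list set" where
  "label_class h k = {p. semi_baxter p \<and> length p \<ge> 1 \<and> label p = (h, k)}"

definition S_hk :: "nat \<Rightarrow> nat \<Rightarrow> 'a::comm_ring_1 fps" where
  "S_hk h k = Abs_fps (\<lambda>n. of_nat (card {p \<in> label_class h k. length p = n}))"

text \<open>
  The series \<open>S(x; y, z)\<close>, with \<open>y\<close> and \<open>z\<close> arbitrary elements of the coefficient ring, so that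
  \<open>S(1, z)\<close> and \<open>S(y, y)\<close> are instances. The infinite sum over \<open>(h, k)\<close> is taken in the
  \<open>x\<close>-adic topology; it converges by \<open>S_gf_has_sum\<close> below.
\<close>

definition S_gf :: "'a::comm_ring_1 \<Rightarrow> 'a \<Rightarrow> 'a fps" where
  "S_gf y z = (\<Sum>\<^sub>\<infinity>(h, k)\<in>{1..} \<times> {1..}. S_hk h k * fps_const (y ^ h * z ^ k))"

text \<open>
  The field of rational functions in two indeterminates \<open>y\<close> and \<open>z\<close>, as the fraction field of
  \<open>\<int>[z][y]\<close>.
\<close>

type_synonym ratfun2 = "int poly poly fract"

definition var_y :: ratfun2 where
  "var_y = to_fract [:0, 1:]"

definition var_z :: ratfun2 where
  "var_z = to_fract [:[:0, 1:]:]"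

lemma label_bound:
  assumes "p \<in> label_class h k"
  shows "h \<le> length p + 1" and "k \<le> length p + 1"
proof -
  have *: "card {a \<in> active_sites p. P a} \<le> length p + 1" for P
  proof -
    have "card {a \<in> active_sites p. P a} \<le> card {1..length p + 1}"
      by (rule card_mono) (auto simp: active_sites_def)
    then show ?thesis by simp
  qed
  show "h \<le> length p + 1" "k \<le> length p + 1"
    using assms *[of "\<lambda>a. a \<le> last p"] *[of "\<lambda>a. a > last p"]
    by (simp_all add: label_class_def label_def)
qed

lemma S_hk_nth_eq_0:
  assumes "h > n + 1 \<or> k > n + 1"
  shows "fps_nth (S_hk h k) n = 0"
proof -
  have "{p \<in> label_class h k. length p = n} = {}"
    using assms label_bound by fastforce
  then have "card {p \<in> label_class h k. length p = n} = 0" by (simp only: card.empty)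
  then show ?thesis by (simp only: S_hk_def fps_nth_Abs_fps of_nat_0)
qed

lemma S_gf_has_sum:
  "((\<lambda>(h, k). S_hk h k * fps_const (y ^ h * z ^ k)) has_sum
      Abs_fps (\<lambda>n. \<Sum>(h, k)\<in>{1..n + 1} \<times> {1..n + 1}. fps_nth (S_hk h k) n * (y ^ h * z ^ k)))
   ({1..} \<times> {1..})"
proof (rule has_sum_fpsI)
  fix n :: nat
  let ?f = "\<lambda>i. fps_nth (case i of (h, k) \<Rightarrow> S_hk h k * fps_const (y ^ h * z ^ k)) n"
  let ?B = "{1..n + 1} \<times> {1..n + 1}"
  have sub: "{i \<in> {1..} \<times> {1..}. ?f i \<noteq> 0} \<subseteq> ?B"
  proof
    fix i :: "nat \<times> nat" assume i: "i \<in> {i \<in> {1..} \<times> {1..}. ?f i \<noteq> 0}"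
    obtain h k where hk: "i = (h, k)" by (cases i)
    have "\<not> (h > n + 1 \<or> k > n + 1)"
    proof
      assume "h > n + 1 \<or> k > n + 1"
      then have "fps_nth (S_hk h k :: 'a fps) n = 0" by (rule S_hk_nth_eq_0)
      with i hk show False by simp
    qed
    with i hk show "i \<in> ?B" by auto
  qed
  then show "finite {i \<in> {1..} \<times> {1..}. ?f i \<noteq> 0}"
    by (rule finite_subset) simp
  have "(\<Sum>i\<in>?B. ?f i) = (\<Sum>i | i \<in> {1..} \<times> {1..} \<and> ?f i \<noteq> 0. ?f i)"
    by (rule sum.mono_neutral_right) (use sub in auto)
  then show "fps_nth (Abs_fps (\<lambda>n. \<Sum>(h, k)\<in>{1..n + 1} \<times> {1..n + 1}.
      fps_nth (S_hk h k) n * (y ^ h * z ^ k))) n =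
      (\<Sum>i | i \<in> {1..} \<times> {1..} \<and> ?f i \<noteq> 0. ?f i)"
    by (simp add: case_prod_unfold)
qed

lemma fps_nth_S_gf:
  "fps_nth (S_gf y z) n =
     (\<Sum>(h, k)\<in>{1..n + 1} \<times> {1..n + 1}. fps_nth (S_hk h k) n * (y ^ h * z ^ k))"
  using infsumI[OF S_gf_has_sum[of y z]] by (simp only: S_gf_def fps_nth_Abs_fps)

end

theory Submission
  imports Defs
begin

text \<open>
  Every semi-Baxter permutation of size \<open>n + 1\<close> is \<open>\<pi> \<cdot> a\<close> for exactly one semi-Baxter
  \<open>\<pi>\<close> of size \<open>n\<close> and one active site \<open>a\<close> of \<open>\<pi>\<close>, because deleting the last entry cannot
  create a forbidden pattern (\<open>semi_baxters_Suc\<close>). The permutations thus form a tree, and the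
  equation expresses how the labels of the children of a node depend on the label of the node.

  A forbidden pattern that uses a new last entry \<open>a\<close> has it in the place of
  \<open>\<pi>\<^sub>k\<close>, so \<open>a\<close> is inactive exactly when some \<open>i < j\<close> with
  \<open>\<pi>\<^sub>j\<^sub>+\<^sub>1 < \<pi>\<^sub>i < a \<le> \<pi>\<^sub>j\<close> exist. Appending \<open>a\<close> keeps all the old obstructions, and
  creates new ones only if \<open>a \<le> \<pi>\<^sub>n\<close>. In that case the active sites \<open>b\<close> with
  \<open>a < b \<le> \<pi>\<^sub>n\<close> are lost (\<open>active_sites_append_value\<close>). In both cases the site \<open>a\<close>
  splits into the two sites \<open>a\<close> and \<open>a + 1\<close>, immediately below and above the new last entry.
  Consequently a node with label \<open>(h, k)\<close> has children with labels
  \<open>(1, k + 1), \<dots>, (h, k + 1)\<close>, one for each active site that is at most the last entry,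
  and \<open>(h + 1, k), \<dots>, (h + k, 1)\<close>, one for each larger active site.

  If a node contributes the monomial \<open>y\<^sup>h z\<^sup>k\<close>, its children contribute
  \<open>(y + \<dots> + y\<^sup>h) z\<^sup>k\<^sup>+\<^sup>1 + y\<^sup>h (y z\<^sup>k + \<dots> + y\<^sup>k z)\<close>. Closing
  both geometric sums turns this into
  \<open>yz/(1 - y) \<cdot> (z\<^sup>k - y\<^sup>h z\<^sup>k) + yz/(z - y) \<cdot> (y\<^sup>h z\<^sup>k - y\<^sup>h y\<^sup>k)\<close>
  (\<open>sum_weight_children_field\<close>). Summing over all nodes gives the last two terms of the
  equation, and the root of the tree, the permutation of size 1 with label \<open>(1, 1)\<close>, gives
  the term \<open>xyz\<close>.
\<close>

section \<open>Appending a last value\<close>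

definition shift :: "nat \<Rightarrow> nat \<Rightarrow> nat" where
  "shift a v = (if v < a then v else v + 1)"

lemma append_value_shift: "append_value p a = map (shift a) p @ [a]"
  by (simp add: append_value_def shift_def[abs_def])

lemma shift_less_iff [simp]: "shift a v < shift a w \<longleftrightarrow> v < w"
  by (auto simp: shift_def)

lemma inj_shift: "inj_on (shift a) A"
  by (auto simp: shift_def inj_on_def split: if_splits)

lemma shift_image:
  assumes "a \<in> {1..n + 1}"
  shows "shift a ` {1..n} = {1..n + 1} - {a}"
proof (intro equalityI subsetI)
  fix v assume "v \<in> {1..n + 1} - {a}"
  then have "v = shift a (if v < a then v else v - 1)" "(if v < a then v else v - 1) \<in> {1..n}"
    using assms by (auto simp: shift_def)
  then show "v \<in> shift a ` {1..n}" by blast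
qed (use assms in \<open>auto simp: shift_def split: if_splits\<close>)

lemma length_append_value [simp]: "length (append_value p a) = length p + 1"
  by (simp add: append_value_def)

lemma last_append_value [simp]: "last (append_value p a) = a"
  by (simp add: append_value_def)

lemma append_value_inj: "append_value p a = append_value q b \<Longrightarrow> p = q \<and> a = b"
  by (auto simp: append_value_shift dest!: map_inj_on[OF _ inj_shift])

lemma nth_append_value:
  "i < length p \<Longrightarrow> append_value p a ! i = shift a (p ! i)"
  "append_value p a ! length p = a"
  by (simp_all add: append_value_shift nth_append)

lemma append_value_perm:
  assumes "p \<in> permutations_of_set {1..n}" "a \<in> {1..n + 1}"
  shows "append_value p a \<in> permutations_of_set {1..n + 1}"
  using assms shift_image[OF assms(2)]
  by (auto simp: permutations_of_set_def append_value_shift distinct_map inj_shift)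

lemma perm_eq_append_value:
  assumes "q \<in> permutations_of_set {1..n + 1}"
  obtains p a where "p \<in> permutations_of_set {1..n}" "a \<in> {1..n + 1}" "q = append_value p a"
proof -
  have q: "set q = {1..n + 1}" "distinct q"
    using assms by (auto simp: permutations_of_set_def)
  then have "q \<noteq> []" by auto
  define a r where "a = last q" and "r = butlast q"
  have qr: "q = r @ [a]"
    using \<open>q \<noteq> []\<close> by (simp add: a_def r_def)
  have a: "a \<in> {1..n + 1}"
    using q(1) qr by auto
  have "set r = {1..n + 1} - {a}"
    using q qr by auto
  then have sr: "set r = shift a ` {1..n}"
    by (simp only: shift_image[OF a])
  then have "set r \<subseteq> range (shift a)" by auto
  then obtain p where p: "r = map (shift a) p"
    by (metis ex_map_conv image_iff subset_iff)
  have "distinct p"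
    using q(2) qr p by (auto simp: distinct_map)
  moreover have "set p = {1..n}"
    using sr p inj_shift[of a UNIV] by (simp add: inj_image_eq_iff)
  ultimately show ?thesis
    using that[of p a] a qr p by (auto simp: permutations_of_set_def append_value_shift)
qed

section \<open>Active sites under appending\<close>

text \<open>
  The pair \<open>i, j\<close> completes to a forbidden pattern once \<open>a\<close> is appended. The bound
  \<open>a \<le> p ! j\<close> is weak because appending \<open>a\<close> raises the entries that are at least \<open>a\<close>.
\<close>

definition blocked :: "nat list \<Rightarrow> nat \<Rightarrow> bool" where
  "blocked p a \<longleftrightarrow>
     (\<exists>i j. i < j \<and> j + 1 < length p \<and> p ! (j + 1) < p ! i \<and> p ! i < a \<and> a \<le> p ! j)"

text \<open>
  Sites are gaps between values. Inserting \<open>a\<close> into the gap \<open>a\<close> divides it into the gaps \<open>a\<close>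
  and \<open>a + 1\<close> and moves the higher gaps up by one, so the gap \<open>b\<close> of the longer permutation lies
  inside the gap \<open>if b \<le> a then b else b - 1\<close> of the shorter one.
\<close>

lemma shift_less_site: "shift a v < b \<longleftrightarrow> v < (if b \<le> a then b else b - 1)"
  by (auto simp: shift_def)

lemma site_le_shift: "b \<le> shift a v \<longleftrightarrow> (if b \<le> a then b else b - 1) \<le> v"
  by (auto simp: shift_def)

lemma semi_baxter_perm: "semi_baxter p \<Longrightarrow> p \<in> permutations_of_set {1..length p}"
  by (simp add: semi_baxter_def)

lemma semi_baxter_append_value_iff:
  assumes "p \<in> permutations_of_set {1..length p}" "a \<in> {1..length p + 1}"
  shows "semi_baxter (append_value p a) \<longleftrightarrow> semi_baxter p \<and> \<not> blocked p a"
proof -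
  let ?q = "append_value p a"
  let ?pat = "\<lambda>r i j k. i < j \<and> j + 1 < k \<and> k < length r \<and>
    r ! (j + 1) < r ! i \<and> r ! i < r ! k \<and> r ! k < r ! j"
  have last: "?pat ?q i j (length p) \<longleftrightarrow>
      i < j \<and> j + 1 < length p \<and> p ! (j + 1) < p ! i \<and> p ! i < a \<and> a \<le> p ! j" for i j
    by (auto simp: nth_append_value shift_def split: if_splits)
  have old: "?pat ?q i j k \<longleftrightarrow> ?pat p i j k" if "k < length p" for i j k
    using that by (auto simp: nth_append_value)
  have "(\<exists>i j k. ?pat ?q i j k) \<longleftrightarrow> (\<exists>i j k. ?pat p i j k) \<or> blocked p a"
  proof
    assume "\<exists>i j k. ?pat ?q i j k"
    then obtain i j k where ijk: "?pat ?q i j k" by blast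
    then consider "k = length p" | "k < length p" by fastforce
    then show "(\<exists>i j k. ?pat p i j k) \<or> blocked p a"
    proof cases
      case 1
      then show ?thesis using ijk last unfolding blocked_def by blast
    next
      case 2
      then show ?thesis using ijk old by blast
    qed
  next
    assume "(\<exists>i j k. ?pat p i j k) \<or> blocked p a"
    then show "\<exists>i j k. ?pat ?q i j k"
      using last old unfolding blocked_def by metis
  qed
  then show ?thesis
    using assms append_value_perm[OF assms] by (simp add: semi_baxter_def)
qed

lemma active_sites_eq:
  assumes "semi_baxter p"
  shows "active_sites p = {a \<in> {1..length p + 1}. \<not> blocked p a}"
  using assms semi_baxter_append_value_iff[OF semi_baxter_perm[OF assms]]
  by (auto simp: active_sites_def)

text \<open>
  The first disjunct collects the obstructions whose descent lies inside \<open>p\<close>. The only other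
  descent that can occur is the final one, from the shifted \<open>last p\<close> down to \<open>a\<close>. It blocks
  the sites up to the shifted \<open>last p\<close> that have an earlier entry above \<open>a\<close> below them. If
  \<open>a < last p\<close>, the lowest such entry is \<open>a + 1\<close>; otherwise the final descent blocks no site.
\<close>

lemma blocked_append_value_iff:
  assumes p: "p \<in> permutations_of_set {1..length p}" and ne: "p \<noteq> []"
    and a: "a \<in> {1..length p + 1}"
  shows "blocked (append_value p a) b \<longleftrightarrow>
    blocked p (if b \<le> a then b else b - 1) \<or> (a + 1 < b \<and> b \<le> last p + 1)"
proof -
  let ?q = "append_value p a" and ?n = "length p"
  let ?b = "if b \<le> a then b else b - 1"
  let ?pat = "\<lambda>r b i j. i < j \<and> j + 1 < length r \<and> r ! (j + 1) < r ! i \<and> r ! i < b \<and> b \<le> r ! j"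
  have old: "?pat ?q b i j \<longleftrightarrow> ?pat p ?b i j" if "j + 1 < ?n" for i j
  proof -
    have "?pat ?q b i j \<longleftrightarrow>
        i < j \<and> p ! (j + 1) < p ! i \<and> shift a (p ! i) < b \<and> b \<le> shift a (p ! j)"
      using that by (cases "i < j") (simp_all add: nth_append_value)
    then show ?thesis
      using that by (simp add: shift_less_site site_le_shift)
  qed
  have new: "(\<exists>i. ?pat ?q b i (?n - 1)) \<longleftrightarrow> a + 1 < b \<and> b \<le> last p + 1"
  proof
    assume "\<exists>i. ?pat ?q b i (?n - 1)"
    then obtain i where i: "i < ?n - 1" "a < shift a (p ! i)" "shift a (p ! i) < b"
        "b \<le> shift a (last p)"
      using ne by (auto simp: nth_append_value last_conv_nth)
    then show "a + 1 < b \<and> b \<le> last p + 1"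
      by (auto simp: shift_def split: if_splits)
  next
    assume b: "a + 1 < b \<and> b \<le> last p + 1"
    have sp: "set p = {1..?n}"
      using p by (simp add: permutations_of_set_def)
    have "last p \<in> set p" using ne by simp
    \<comment> \<open>The entry \<open>a\<close> of \<open>p\<close> becomes \<open>a + 1\<close> and plays the role of the 2 in the pattern 2-41-3.\<close>
    then have "a \<in> set p"
      using a b sp by auto
    then obtain i where i: "i < ?n" "p ! i = a"
      by (auto simp: in_set_conv_nth)
    moreover have "i \<noteq> ?n - 1"
      using i b ne by (auto simp: last_conv_nth)
    ultimately have "?pat ?q b i (?n - 1)"
      using b ne by (auto simp: nth_append_value shift_def last_conv_nth)
    then show "\<exists>i. ?pat ?q b i (?n - 1)" by blast
  qed
  have split: "(\<exists>i j. ?pat ?q b i j) \<longleftrightarrow>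
      (\<exists>i j. j + 1 < ?n \<and> ?pat ?q b i j) \<or> (\<exists>i. ?pat ?q b i (?n - 1))"
  proof -
    have "j = ?n - 1 \<or> j + 1 < ?n" if "?pat ?q b i j" for i j
      using that by auto
    then show ?thesis by blast
  qed
  have "(\<exists>i j. j + 1 < ?n \<and> ?pat ?q b i j) \<longleftrightarrow> blocked p ?b"
    unfolding blocked_def using old by metis
  then show ?thesis
    unfolding blocked_def[of ?q] split new by simp
qed

lemma active_sites_append_value:
  assumes p: "semi_baxter p" and ne: "p \<noteq> []" and a: "a \<in> active_sites p"
  shows "active_sites (append_value p a) =
    {b \<in> active_sites p. b \<le> a} \<union>
    Suc ` {b \<in> active_sites p. a \<le> b \<and> (b = a \<or> last p < b)}"
    (is "_ = ?L \<union> Suc ` ?R")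
proof -
  have perm: "p \<in> permutations_of_set {1..length p}"
    by (rule semi_baxter_perm[OF p])
  have a': "a \<in> {1..length p + 1}" and "semi_baxter (append_value p a)"
    using a by (simp_all add: active_sites_def)
  then have eq: "active_sites (append_value p a) =
      {b \<in> {1..length p + 2}. \<not> blocked p (if b \<le> a then b else b - 1) \<and>
        \<not> (a + 1 < b \<and> b \<le> last p + 1)}"
    by (simp add: active_sites_eq blocked_append_value_iff[OF perm ne a'])
  have "b \<in> active_sites (append_value p a) \<longleftrightarrow> b \<in> ?L \<union> Suc ` ?R" for b
  proof (cases "b \<le> a")
    case True
    then show ?thesis
      using a' by (auto simp: eq active_sites_eq[OF p])
  next
    case False
    then obtain c where "b = Suc c" "a \<le> c"
      by (cases b) auto
    then show ?thesis
      using a' by (auto simp: eq active_sites_eq[OF p])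
  qed
  then show ?thesis by blast
qed

section \<open>The succession rule for labels\<close>

definition low :: "nat list \<Rightarrow> nat set" where
  "low p = {a \<in> active_sites p. a \<le> last p}"

definition high :: "nat list \<Rightarrow> nat set" where
  "high p = {a \<in> active_sites p. a > last p}"

lemma label_low_high: "label p = (card (low p), card (high p))"
  by (simp add: label_def low_def high_def)

lemma finite_active_sites [simp]: "finite (active_sites p)"
  by (simp add: active_sites_def)

lemma finite_low [simp]: "finite (low p)" and finite_high [simp]: "finite (high p)"
  by (simp_all add: low_def high_def)

lemma active_sites_low_high: "active_sites p = low p \<union> high p" "low p \<inter> high p = {}"
  by (auto simp: low_def high_def)

text \<open>
  All active sites above \<open>last p\<close> survive, and the upper half of the divided site \<open>a\<close> joins them,
  while the active sites \<open>b\<close> with \<open>a < b \<le> last p\<close> become blocked.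
\<close>

lemma label_append_low:
  assumes "semi_baxter p" "p \<noteq> []" "a \<in> low p"
  shows "label (append_value p a) = (card {b \<in> low p. b \<le> a}, card (high p) + 1)"
proof -
  have a: "a \<in> active_sites p" "a \<le> last p"
    using assms(3) by (auto simp: low_def)
  note act = active_sites_append_value[OF assms(1,2) a(1)]
  have "low (append_value p a) = {b \<in> low p. b \<le> a}"
    using a(2) by (auto simp: act low_def)
  moreover have "high (append_value p a) = Suc ` insert a (high p)"
    using a by (auto simp: act high_def)
  then have "card (high (append_value p a)) = card (insert a (high p))"
    by (simp only: card_image inj_Suc)
  moreover have "a \<notin> high p"
    using a by (simp add: high_def)
  ultimately show ?thesis
    by (simp add: label_low_high card_image)
qed

text \<open>
  The longer permutation ends in an ascent, so no new obstruction arises. The site \<open>a\<close> is counted on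
  both sides since its two halves are separated by the new last entry.
\<close>

lemma label_append_high:
  assumes "semi_baxter p" "p \<noteq> []" "a \<in> high p"
  shows "label (append_value p a) =
    (card (low p) + card {b \<in> high p. b \<le> a}, card {b \<in> high p. a \<le> b})"
proof -
  have a: "a \<in> active_sites p" "last p < a"
    using assms(3) by (auto simp: high_def)
  note act = active_sites_append_value[OF assms(1,2) a(1)]
  have "low (append_value p a) = low p \<union> {b \<in> high p. b \<le> a}"
    using a(2) by (auto simp: act low_def high_def)
  moreover have "low p \<inter> {b \<in> high p. b \<le> a} = {}"
    using active_sites_low_high(2)[of p] by auto
  moreover have "high (append_value p a) = Suc ` {b \<in> high p. a \<le> b}"
    using a by (auto simp: act high_def)
  ultimately show ?thesis
    by (simp add: label_low_high card_image card_Un_disjoint)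
qed

section \<open>Weights of the children\<close>

text \<open>
  The labels of the children depend on a site only through its rank among the active sites on its
  side of the last entry; this turns sums over sites into sums over \<open>1, \<dots>, h\<close> and
  \<open>1, \<dots>, k\<close>.
\<close>

lemma bij_betw_rank:
  fixes A :: "'a::linorder set"
  assumes "finite A"
  shows "bij_betw (\<lambda>a. card {b \<in> A. b \<le> a}) A {1..card A}"
proof -
  let ?r = "\<lambda>a. card {b \<in> A. b \<le> a}"
  have "strict_mono_on A ?r"
  proof (rule strict_mono_onI)
    fix a b assume "a \<in> A" "b \<in> A" "a < b"
    then have "{c \<in> A. c \<le> a} \<subseteq> {c \<in> A. c \<le> b}" "b \<in> {c \<in> A. c \<le> b}" "b \<notin> {c \<in> A. c \<le> a}"
      by auto
    then have "{c \<in> A. c \<le> a} \<subset> {c \<in> A. c \<le> b}" by blast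
    then show "?r a < ?r b" using assms by (intro psubset_card_mono) auto
  qed
  then have inj: "inj_on ?r A"
    by (rule strict_mono_on_imp_inj_on)
  have "?r a \<in> {1..card A}" if "a \<in> A" for a
  proof -
    have "0 < ?r a" using that assms by (auto simp: card_gt_0_iff)
    moreover have "?r a \<le> card A" using assms by (intro card_mono) auto
    ultimately show ?thesis by simp
  qed
  then have "?r ` A \<subseteq> {1..card A}" by blast
  then have "?r ` A = {1..card A}"
    by (intro card_subset_eq) (simp_all add: card_image inj)
  with inj show ?thesis by (simp add: bij_betw_def)
qed

lemma sum_rank:
  fixes A :: "'a::linorder set"
  assumes "finite A"
  shows "(\<Sum>a\<in>A. f (card {b \<in> A. b \<le> a})) = sum f {1..card A}"
  by (rule sum.reindex_bij_betw[OF bij_betw_rank[OF assms]])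

lemma card_ge_rank:
  fixes A :: "'a::linorder set"
  assumes "finite A" "a \<in> A"
  shows "card {b \<in> A. a \<le> b} = card A + 1 - card {b \<in> A. b \<le> a}"
proof -
  have "card {b \<in> A. a \<le> b} + card {b \<in> A. b \<le> a} =
      card ({b \<in> A. a \<le> b} \<union> {b \<in> A. b \<le> a}) + card ({b \<in> A. a \<le> b} \<inter> {b \<in> A. b \<le> a})"
    using assms by (intro card_Un_Int) auto
  moreover have "{b \<in> A. a \<le> b} \<union> {b \<in> A. b \<le> a} = A" by auto
  moreover have "{b \<in> A. a \<le> b} \<inter> {b \<in> A. b \<le> a} = {a}" using assms by auto
  ultimately show ?thesis by simp
qed

definition weight :: "'a::comm_ring_1 \<Rightarrow> 'a \<Rightarrow> nat list \<Rightarrow> 'a" where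
  "weight y z p = y ^ fst (label p) * z ^ snd (label p)"

lemma sum_weight_children:
  fixes y z :: "'a::comm_ring_1"
  assumes "semi_baxter p" "p \<noteq> []"
  shows "(\<Sum>a\<in>active_sites p. weight y z (append_value p a)) =
    (\<Sum>j=1..card (low p). y ^ j) * z ^ (card (high p) + 1) +
    y ^ card (low p) * (\<Sum>j=1..card (high p). y ^ j * z ^ (card (high p) + 1 - j))"
proof -
  have "(\<Sum>a\<in>low p. weight y z (append_value p a)) =
      (\<Sum>a\<in>low p. y ^ card {b \<in> low p. b \<le> a} * z ^ (card (high p) + 1))"
    by (intro sum.cong refl) (simp add: weight_def label_append_low assms)
  also have "\<dots> = (\<Sum>j=1..card (low p). y ^ j) * z ^ (card (high p) + 1)"
    by (simp add: sum_rank[where f = "\<lambda>j. y ^ j"] flip: sum_distrib_right)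
  finally have low: "(\<Sum>a\<in>low p. weight y z (append_value p a)) = \<dots>" .
  have "(\<Sum>a\<in>high p. weight y z (append_value p a)) =
      (\<Sum>a\<in>high p. y ^ card (low p) * (y ^ card {b \<in> high p. b \<le> a} *
        z ^ (card (high p) + 1 - card {b \<in> high p. b \<le> a})))"
    by (intro sum.cong refl)
      (simp add: weight_def label_append_high assms card_ge_rank power_add mult.assoc)
  also have "\<dots> = y ^ card (low p) * (\<Sum>j=1..card (high p). y ^ j * z ^ (card (high p) + 1 - j))"
    by (simp only: sum_distrib_left[symmetric]
        sum_rank[OF finite_high, where f = "\<lambda>j. y ^ j * z ^ (card (high p) + 1 - j)" for p])
  finally show ?thesis
    by (simp add: active_sites_low_high sum.union_disjoint low)
qed

lemma diff_power_eq_sum_from_1: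
  fixes y z :: "'a::comm_ring_1"
  shows "(z - y) * (\<Sum>j=1..k. y ^ j * z ^ (k + 1 - j)) = y * z * (z ^ k - y ^ k)"
proof (induction k)
  case (Suc k)
  have "(\<Sum>j=1..Suc k. y ^ j * z ^ (Suc k + 1 - j)) =
      z * (\<Sum>j=1..k. y ^ j * z ^ (k + 1 - j)) + y ^ Suc k * z"
    by (simp add: sum_distrib_left Suc_diff_le algebra_simps)
  then have "(z - y) * (\<Sum>j=1..Suc k. y ^ j * z ^ (Suc k + 1 - j)) =
      z * ((z - y) * (\<Sum>j=1..k. y ^ j * z ^ (k + 1 - j))) + (z - y) * (y ^ Suc k * z)"
    by (simp only: distrib_left mult.left_commute)
  also have "\<dots> = y * z * (z ^ Suc k - y ^ Suc k)"
    unfolding Suc.IH by (simp add: algebra_simps)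
  finally show ?case .
qed simp

text \<open>
  Both sums are instances of \<open>diff_power_eq_sum_from_1\<close>. The result involves the node only through
  its weights at \<open>(1, z)\<close>, \<open>(y, z)\<close> and \<open>(y, y)\<close>, which is why it can be summed over all nodes.
\<close>

lemma sum_weight_children_field:
  fixes y z :: "'a::field"
  assumes "semi_baxter p" "p \<noteq> []" "y \<noteq> 1" "z \<noteq> y"
  shows "(\<Sum>a\<in>active_sites p. weight y z (append_value p a)) =
    y * z / (1 - y) * (weight 1 z p - weight y z p) +
    y * z / (z - y) * (weight y z p - weight y y p)"
proof -
  let ?h = "card (low p)" and ?k = "card (high p)"
  have low: "(\<Sum>j=1..?h. y ^ j) = y * (1 - y ^ ?h) / (1 - y)"
    using diff_power_eq_sum_from_1[where y = y and z = 1 and k = ?h] assms(3)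
    by (simp add: eq_divide_eq mult.commute)
  have high: "(\<Sum>j=1..?k. y ^ j * z ^ (?k + 1 - j)) = y * z * (z ^ ?k - y ^ ?k) / (z - y)"
    using diff_power_eq_sum_from_1[where y = y and z = z and k = ?k] assms(4)
    by (simp add: eq_divide_eq mult.commute)
  show ?thesis
    unfolding sum_weight_children[OF assms(1,2)] low high
    by (simp add: weight_def label_low_high divide_inverse algebra_simps)
qed

section \<open>The generating tree\<close>

definition semi_baxters :: "nat \<Rightarrow> nat list set" where
  "semi_baxters n = {p. semi_baxter p \<and> length p = n}"

lemma finite_semi_baxters [simp]: "finite (semi_baxters n)"
  by (rule finite_subset[of _ "permutations_of_set {1..n}"])
    (auto simp: semi_baxters_def dest: semi_baxter_perm)

lemma semi_baxters_Suc:
  "bij_betw (\<lambda>(p, a). append_value p a) (SIGMA p:semi_baxters n. active_sites p)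
    (semi_baxters (Suc n))"
proof (rule bij_betw_imageI)
  show "inj_on (\<lambda>(p, a). append_value p a) (SIGMA p:semi_baxters n. active_sites p)"
    by (auto simp: inj_on_def dest: append_value_inj)
next
  show "(\<lambda>(p, a). append_value p a) ` (SIGMA p:semi_baxters n. active_sites p) =
    semi_baxters (Suc n)"
  proof (intro equalityI subsetI)
    fix q assume q: "q \<in> semi_baxters (Suc n)"
    then have "q \<in> permutations_of_set {1..n + 1}"
      using semi_baxter_perm[of q] by (simp add: semi_baxters_def)
    then obtain p a where pa: "p \<in> permutations_of_set {1..n}" "a \<in> {1..n + 1}"
        "q = append_value p a"
      by (rule perm_eq_append_value)
    then have "length p = n"
      using q by (simp add: semi_baxters_def)
    with pa q have "p \<in> semi_baxters n" "a \<in> active_sites p"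
      using semi_baxter_append_value_iff[of p a]
      by (auto simp: semi_baxters_def active_sites_def)
    then show "q \<in> (\<lambda>(p, a). append_value p a) ` (SIGMA p:semi_baxters n. active_sites p)"
      using pa by force
  qed (auto simp: semi_baxters_def active_sites_def)
qed

text \<open>
  The extreme sites \<open>1\<close> and \<open>length p + 1\<close> are always active, so no permutation is lost by
  restricting the generating function to \<open>h, k \<ge> 1\<close>.
\<close>

lemma card_low_high_pos:
  assumes p: "semi_baxter p" and ne: "p \<noteq> []"
  shows "1 \<le> card (low p)" "1 \<le> card (high p)"
proof -
  have sp: "set p = {1..length p}"
    using semi_baxter_perm[OF p] by (simp add: permutations_of_set_def)
  then have last: "last p \<in> {1..length p}"
    using last_in_set[OF ne] by simp
  have le: "p ! i \<in> {1..length p}" if "i < length p" for i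
    using nth_mem[OF that] sp by simp
  have blocked_range: "1 < a \<and> a \<le> length p" if blocked: "blocked p a" for a
  proof -
    obtain i j where "i < j" "j + 1 < length p" "p ! i < a" "a \<le> p ! j"
      using blocked by (auto simp: blocked_def)
    then show ?thesis using le[of i] le[of j] by simp
  qed
  have "1 \<in> low p"
    using last blocked_range[of 1] by (auto simp: low_def active_sites_eq[OF p])
  moreover have "length p + 1 \<in> high p"
    using last blocked_range[of "length p + 1"] by (auto simp: high_def active_sites_eq[OF p])
  ultimately show "1 \<le> card (low p)" "1 \<le> card (high p)"
    by (auto simp: Suc_le_eq card_gt_0_iff)
qed

section \<open>Coefficients of the generating function\<close>

lemma fps_nth_S_gf_0: "fps_nth (S_gf y z) 0 = 0"
proof -
  have "{p \<in> label_class h k. length p = 0} = {}" for h k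
    by (auto simp: label_class_def)
  then show ?thesis
    by (simp only: fps_nth_S_gf S_hk_def fps_nth_Abs_fps card.empty) simp
qed

lemma fps_nth_S_gf_Suc:
  fixes y z :: "'a::comm_ring_1"
  shows "fps_nth (S_gf y z) (Suc n) = (\<Sum>p\<in>semi_baxters (Suc n). weight y z p)"
proof -
  let ?B = "{1..Suc n + 1} \<times> {1..Suc n + 1}" and ?A = "semi_baxters (Suc n)"
  have cls: "{p \<in> label_class h k. length p = Suc n} = {p \<in> ?A. label p = (h, k)}" for h k
    by (auto simp: label_class_def semi_baxters_def)
  have "label ` ?A \<subseteq> ?B"
  proof
    fix l assume "l \<in> label ` ?A"
    then obtain p where p: "semi_baxter p" "length p = Suc n" "l = label p"
      by (auto simp: semi_baxters_def)
    then have "p \<in> label_class (fst l) (snd l)"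
      by (simp add: label_class_def)
    from label_bound[OF this] card_low_high_pos[OF p(1)] p show "l \<in> ?B"
      by (cases p) (auto simp: label_low_high)
  qed
  then have "(\<Sum>p\<in>?A. weight y z p) = (\<Sum>l\<in>?B. \<Sum>p\<in>{p \<in> ?A. label p = l}. weight y z p)"
    by (intro sum.group[symmetric]) auto
  also have "\<dots> = (\<Sum>(h, k)\<in>?B. fps_nth (S_hk h k) (Suc n) * (y ^ h * z ^ k))"
    by (rule sum.cong) (auto simp: S_hk_def cls weight_def)
  finally show ?thesis
    by (simp only: fps_nth_S_gf)
qed

lemma semi_baxters_1: "semi_baxters 1 = {[1]}"
proof -
  have "permutations_of_set {1..1::nat} = {[1]}"
    by simp
  moreover have "semi_baxter [1]"
    by (simp add: semi_baxter_def)
  ultimately show ?thesis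
    by (auto simp: semi_baxters_def dest: semi_baxter_perm)
qed

lemma label_singleton: "label [1] = (1, 1)"
proof -
  have "semi_baxter [1]"
    using semi_baxters_1 by (auto simp: semi_baxters_def)
  then have "active_sites [1] = {1, 2}"
    by (auto simp: active_sites_eq blocked_def)
  then have "low [1] = {1}" "high [1] = {2}"
    by (auto simp: low_def high_def)
  then show ?thesis
    by (simp add: label_low_high)
qed

section \<open>The functional equation\<close>

text \<open>
  Comparing coefficients of \<open>x\<^sup>n\<close>: both sides vanish for \<open>n = 0\<close>, the root gives the case
  \<open>n = 1\<close>, and for larger \<open>n\<close> the permutations of size \<open>n\<close> are grouped by their parents.
\<close>

theorem S_gf_equation:
  fixes y z :: "'a::field"
  assumes "y \<noteq> 1" "z \<noteq> y"
  shows "S_gf y z =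
     fps_X * fps_const (y * z)
   + fps_X * fps_const (y * z) / fps_const (1 - y) * (S_gf 1 z - S_gf y z)
   + fps_X * fps_const (y * z) / fps_const (z - y) * (S_gf y z - S_gf y y)"
proof -
  \<comment> \<open>The denominators are units of the power series ring, so the quotients stand for
    multiplication by scalars.\<close>
  have div: "fps_X * fps_const c / fps_const d * F = fps_X * (fps_const (c / d) * F)"
    if "d \<noteq> 0" for c d :: 'a and F
    using that by (simp add: fps_divide_unit fps_const_inverse divide_inverse mult.assoc
        flip: fps_const_mult)
  have "fps_nth (S_gf y z) n = fps_nth (fps_X * (fps_const (y * z)
      + fps_const (y * z / (1 - y)) * (S_gf 1 z - S_gf y z)
      + fps_const (y * z / (z - y)) * (S_gf y z - S_gf y y))) n" for n
  proof (cases n)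
    case 0
    then show ?thesis by (simp add: fps_nth_S_gf_0)
  next
    case (Suc m)
    show ?thesis
    proof (cases m)
      case 0
      then show ?thesis
        using Suc semi_baxters_1 label_singleton
        by (simp add: fps_nth_S_gf_0 fps_nth_S_gf_Suc weight_def)
    next
      case (Suc l)
      have "fps_nth (S_gf y z) (Suc m) =
          (\<Sum>p\<in>semi_baxters m. \<Sum>a\<in>active_sites p. weight y z (append_value p a))"
        unfolding fps_nth_S_gf_Suc sum.reindex_bij_betw[OF semi_baxters_Suc, symmetric]
        by (simp add: sum.Sigma case_prod_unfold)
      also have "\<dots> = (\<Sum>p\<in>semi_baxters m.
          y * z / (1 - y) * (weight 1 z p - weight y z p) +
          y * z / (z - y) * (weight y z p - weight y y p))"
        using Suc by (intro sum.cong refl sum_weight_children_field assms)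
          (auto simp: semi_baxters_def)
      finally show ?thesis
        using \<open>n = Suc m\<close> Suc
        by (simp add: fps_nth_S_gf_Suc sum.distrib sum_subtractf
            flip: sum_divide_distrib sum_distrib_left)
    qed
  qed
  then have "S_gf y z = fps_X * (fps_const (y * z)
      + fps_const (y * z / (1 - y)) * (S_gf 1 z - S_gf y z)
      + fps_const (y * z / (z - y)) * (S_gf y z - S_gf y y))"
    by (rule fps_ext)
  moreover have nz: "1 - y \<noteq> 0" "z - y \<noteq> 0"
    using assms by simp_all
  ultimately show ?thesis
    by (simp only: div[OF nz(1)] div[OF nz(2)] distrib_left)
qed

lemma var_y_neq_1: "var_y \<noteq> 1"
  unfolding var_y_def to_fract_1[symmetric] to_fract_eq_iff by (simp add: one_pCons)

lemma var_z_neq_var_y: "var_z \<noteq> var_y"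
  by (simp add: var_y_def var_z_def)

theorem proposition11:
  "S_gf var_y var_z =
     fps_X * fps_const (var_y * var_z)
   + fps_X * fps_const (var_y * var_z) / fps_const (1 - var_y)
       * (S_gf 1 var_z - S_gf var_y var_z)
   + fps_X * fps_const (var_y * var_z) / fps_const (var_z - var_y)
       * (S_gf var_y var_z - S_gf var_y var_y)"
  by (rule S_gf_equation[OF var_y_neq_1 var_z_neq_var_y])

end
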